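(* Let $(G,P)$ be a lattice ordered group and let $T:P\to\mathcal{B}(\mathcal{H})$ be a contractive representation. For $g\in G$ put $\tilde T(g)=T(g_-)^*T(g_+)$. Then $T$ is regular if and only if for every $n\ge 1$, all $p_1,\dots,p_n\in P$ and every $g\in P$ with $g\wedge p_i=e$ for all $i=1,\dots,n$, one has $$\left[T(g)^*\tilde T(p_ip_j^{-1})T(g)\right]_{1\le i,j\le n}\le\left[\tilde T(p_ip_j^{-1})\right]_{1\le i,j\le n}.$$
   Context: A lattice ordered group $(G,P)$ is a (not necessarily abelian) group $G$ with identity $e$ together with a subsemigroup $P\subseteq G$ containing $e$ such that $PP^{-1}=G$, $P\cap P^{-1}=\{e\}$, $gPg^{-1}\subseteq P$ for all $g\in G$, and such that, for the partial order $x\le y\iff x^{-1}y\in P$, any two elements $x,y\in G$ have a least upper bound $x\vee y$ and a greatest lower bound $x\wedge y$. Every $g\in G$ is uniquely written $g=g_+g_-^{-1}$ with $g_+,g_-\in P$ and $g_+\wedge g_-=e$; namely $g_+=g\vee e$, $g_-=g^{-1}\vee e$. $\mathcal{H}$ is a Hilbert space. A representation $T:P\to\mathcal{B}(\mathcal{H})$ is a unital semigroup homomorphism ($T(e)=I$, $T(pq)=T(p)T(q)$); it is contractive if $\|T(p)\|\le 1$ for all $p\in P$. A unital map $S:G\to\mathcal{B}(\mathcal{H})$ is completely positive definite if $[S(g_i^{-1}g_j)]_{1\le i,j\le n}\ge 0$ for all $n$ and all $g_1,\dots,g_n\in G$ ($i$ is the row index, $j$ the column index; the matrix is an operator on $\mathcal{H}^n$).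 $T$ is regular (i.e. right regular) if $\tilde T$ is completely positive definite on $G$. *)

theory Defs
  imports "HOL-Analysis.Analysis" "HOL-Algebra.Coset" "HOL-Library.Complex_Order"
begin

section \<open>Complex Hilbert spaces and their bounded operators\<close>

text \<open>
  The inner product is linear in the first argument and conjugate linear in the second.
  Positivity and definiteness of \<open>cinner\<close> follow from \<open>cinner_self\<close> and the norm axioms,
  and completeness is part of \<^class>\<open>banach\<close>.
\<close>

class chilbert_space = banach +
  fixes scaleC :: "complex \<Rightarrow> 'a \<Rightarrow> 'a" (infixr \<open>*\<^sub>C\<close> 75)
    and cinner :: "'a \<Rightarrow> 'a \<Rightarrow> complex"
  assumes scaleC_complex_of_real: "complex_of_real r *\<^sub>C x = r *\<^sub>R x"
    and scaleC_add_right: "a *\<^sub>C (x + y) = a *\<^sub>C x + a *\<^sub>C y"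
    and scaleC_add_left: "(a + b) *\<^sub>C x = a *\<^sub>C x + b *\<^sub>C x"
    and scaleC_scaleC: "a *\<^sub>C b *\<^sub>C x = (a * b) *\<^sub>C x"
    and cinner_commute: "cinner x y = cnj (cinner y x)"
    and cinner_add_left: "cinner (x + y) z = cinner x z + cinner y z"
    and cinner_scaleC_left: "cinner (a *\<^sub>C x) y = a * cinner x y"
    and cinner_self: "cinner x x = complex_of_real ((norm x)\<^sup>2)"

definition bounded_ops :: "('h::chilbert_space \<Rightarrow> 'h) set" where
  "bounded_ops = {f. bounded_linear f \<and> (\<forall>a x. f (a *\<^sub>C x) = a *\<^sub>C f x)}"

text \<open>
  For \<open>f \<in> bounded_ops\<close> the function selected here exists and is unique, by the Riesz
  representation theorem.
\<close>

definition cadjoint :: "('h::chilbert_space \<Rightarrow> 'h) \<Rightarrow> 'h \<Rightarrow> 'h" where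
  "cadjoint f = (SOME f'. \<forall>x y. cinner (f x) y = cinner x (f' y))"

section \<open>Operator matrices\<close>

text \<open>
  An \<open>n \<times> n\<close> operator matrix is a function of the row and the column index, of which only the
  entries below \<open>n\<close> matter.  It acts on \<open>H\<^sup>n\<close>, whose elements are likewise represented by
  functions \<open>nat \<Rightarrow> 'h\<close> of which only the components below \<open>n\<close> matter.
\<close>

type_synonym 'h op_matrix = "nat \<Rightarrow> nat \<Rightarrow> 'h \<Rightarrow> 'h"

definition op_matrix_apply :: "nat \<Rightarrow> 'h op_matrix \<Rightarrow> (nat \<Rightarrow> 'h) \<Rightarrow> nat \<Rightarrow> 'h::chilbert_space" where
  "op_matrix_apply n A x = (\<lambda>i. \<Sum>j<n. A i j (x j))"

definition cinner_pow :: "nat \<Rightarrow> (nat \<Rightarrow> 'h) \<Rightarrow> (nat \<Rightarrow> 'h::chilbert_space) \<Rightarrow> complex" where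
  "cinner_pow n x y = (\<Sum>i<n. cinner (x i) (y i))"

text \<open>
  The order on \<^typ>\<open>complex\<close> is the one in which \<open>0 \<le> z\<close> means that \<open>z\<close> is real and nonnegative.
\<close>

definition op_matrix_nonneg :: "nat \<Rightarrow> 'h::chilbert_space op_matrix \<Rightarrow> bool" where
  "op_matrix_nonneg n A \<longleftrightarrow> (\<forall>x. 0 \<le> cinner_pow n (op_matrix_apply n A x) x)"

definition op_matrix_le :: "nat \<Rightarrow> 'h::chilbert_space op_matrix \<Rightarrow> 'h op_matrix \<Rightarrow> bool" where
  "op_matrix_le n A B \<longleftrightarrow> op_matrix_nonneg n (\<lambda>i j h. B i j h - A i j h)"

section \<open>Lattice ordered groups\<close>

definition cone_order :: "('g, 'm) monoid_scheme \<Rightarrow> 'g set \<Rightarrow> 'g gorder" where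
  "cone_order G P =
    \<lparr>carrier = carrier G, eq = (=), le = (\<lambda>x y. inv\<^bsub>G\<^esub> x \<otimes>\<^bsub>G\<^esub> y \<in> P)\<rparr>"

locale lattice_ordered_group = group G for G (structure) +
  fixes P
  assumes cone_subset: "P \<subseteq> carrier G"
    and one_in_cone: "\<one> \<in> P"
    and cone_mult_closed: "\<lbrakk>p \<in> P; q \<in> P\<rbrakk> \<Longrightarrow> p \<otimes> q \<in> P"
    and cone_generates: "P <#> set_inv P = carrier G"
    and cone_pointed: "P \<inter> set_inv P = {\<one>}"
    and cone_conj: "g \<in> carrier G \<Longrightarrow> g <# P #> inv g \<subseteq> P"
    and join_exists: "\<lbrakk>x \<in> carrier G; y \<in> carrier G\<rbrakk> \<Longrightarrow>
          \<exists>s. least (cone_order G P) s (Upper (cone_order G P) {x, y})"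
    and meet_exists: "\<lbrakk>x \<in> carrier G; y \<in> carrier G\<rbrakk> \<Longrightarrow>
          \<exists>s. greatest (cone_order G P) s (Lower (cone_order G P) {x, y})"

definition pos_part :: "('g, 'm) monoid_scheme \<Rightarrow> 'g set \<Rightarrow> 'g \<Rightarrow> 'g" where
  "pos_part G P g = g \<squnion>\<^bsub>cone_order G P\<^esub> \<one>\<^bsub>G\<^esub>"

definition neg_part :: "('g, 'm) monoid_scheme \<Rightarrow> 'g set \<Rightarrow> 'g \<Rightarrow> 'g" where
  "neg_part G P g = inv\<^bsub>G\<^esub> g \<squnion>\<^bsub>cone_order G P\<^esub> \<one>\<^bsub>G\<^esub>"

section \<open>Contractive representations and regularity\<close>

text \<open>The values of \<open>T\<close> outside \<open>P\<close> (and below those of \<open>S\<close> outside the carrier) are irrelevant.\<close>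

definition contractive_representation ::
    "('g, 'm) monoid_scheme \<Rightarrow> 'g set \<Rightarrow> ('g \<Rightarrow> 'h \<Rightarrow> 'h::chilbert_space) \<Rightarrow> bool" where
  "contractive_representation G P T \<longleftrightarrow>
     T \<in> P \<rightarrow> bounded_ops \<and> T \<one>\<^bsub>G\<^esub> = id \<and>
     (\<forall>p\<in>P. \<forall>q\<in>P. T (p \<otimes>\<^bsub>G\<^esub> q) = T p \<circ> T q) \<and>
     (\<forall>p\<in>P. onorm (T p) \<le> 1)"

definition completely_positive_definite ::
    "('g, 'm) monoid_scheme \<Rightarrow> ('g \<Rightarrow> 'h \<Rightarrow> 'h::chilbert_space) \<Rightarrow> bool" where
  "completely_positive_definite G S \<longleftrightarrow>
     S \<in> carrier G \<rightarrow> bounded_ops \<and> S \<one>\<^bsub>G\<^esub> = id \<and>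
     (\<forall>n\<ge>1. \<forall>g. (\<forall>i<n. g i \<in> carrier G) \<longrightarrow>
        op_matrix_nonneg n (\<lambda>i j. S (inv\<^bsub>G\<^esub> (g i) \<otimes>\<^bsub>G\<^esub> g j)))"

definition tilde ::
    "('g, 'm) monoid_scheme \<Rightarrow> 'g set \<Rightarrow> ('g \<Rightarrow> 'h \<Rightarrow> 'h) \<Rightarrow> 'g \<Rightarrow> 'h \<Rightarrow> 'h::chilbert_space" where
  "tilde G P T g = cadjoint (T (neg_part G P g)) \<circ> T (pos_part G P g)"

definition regular_representation ::
    "('g, 'm) monoid_scheme \<Rightarrow> 'g set \<Rightarrow> ('g \<Rightarrow> 'h \<Rightarrow> 'h::chilbert_space) \<Rightarrow> bool" where
  "regular_representation G P T \<longleftrightarrow> completely_positive_definite G (tilde G P T)"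

end

theory Submission
  imports Defs
begin

text \<open>
  Write \<open>x = x\<^sub>+ x\<^sub>-\<^sup>-\<^sup>1\<close> for the canonical decomposition and call two elements of the
  cone disjoint if their meet is the identity.  The operator \<open>tilde G P T x\<close> has the sesquilinear
  form that takes \<open>u\<close> and \<open>v\<close> to the inner product of \<open>T x\<^sub>+ u\<close> and \<open>T x\<^sub>- v\<close>, and regularity
  says that for every family \<open>p\<^sub>1, \<dots>, p\<^sub>n\<close> in the cone the matrix \<open>X\<close> of the forms at
  \<open>p\<^sub>i p\<^sub>j\<^sup>-\<^sup>1\<close> is positive (\<open>regular_iff_quad_form_nonneg\<close>).

  Everything rests on one computation, \<open>tilde_form_mult_disjoint\<close>.  If \<open>g\<close> is disjoint from \<open>p\<close>,
  then \<open>g\<close> commutes with \<open>p\<close>, and the decomposition of \<open>q g p\<^sup>-\<^sup>1\<close> differs from that of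
  \<open>q p\<^sup>-\<^sup>1\<close> only by a factor \<open>g\<close> in the positive part.  So the extra \<open>g\<close> acts on the form as
  \<open>T g\<close> on one argument.  Let \<open>D\<close> be the diagonal matrix with entries \<open>T g\<close>.

  If \<open>T\<close> is regular and \<open>g\<close> is disjoint from all \<open>p\<^sub>i\<close>, the family consisting of the \<open>p\<^sub>i g\<close> and
  the \<open>p\<^sub>i\<close> has a positive block matrix with diagonal blocks \<open>X\<close> and off-diagonal blocks \<open>X D\<close>
  and \<open>D\<^sup>* X\<close>.  Evaluating it at \<open>(- D u, u)\<close> gives \<open>D\<^sup>* X D \<le> X\<close>, which is the claimed
  inequality (\<open>quad_form_disjoint_le\<close>).

  Conversely, suppose that \<open>D\<^sup>* X D \<le> X\<close> holds in all such situations, and take any finite family in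
  the cone.  Choose a largest set of members whose meet \<open>g\<close> is not the identity.  By maximality \<open>g\<close>
  is disjoint from all other members.  Dividing the chosen members by \<open>g\<close> yields a family with fewer
  nontrivial meets, and the matrix of the original family is a congruence transform of the matrix of
  the new one plus a block \<open>X' - D\<^sup>* X' D\<close> for the other members (\<open>quad_form_nonneg_divide\<close>).
  After finitely many divisions all members are the identity, and that matrix is positive
  (\<open>quad_form_nonneg\<close>).

  Adjoints exist by the Riesz representation theorem, which follows from completeness by minimising
  a quadratic functional.
\<close>


section \<open>Inner product and adjoints\<close>

lemma cinner_add_right: "cinner x (y + z) = cinner x y + cinner x (z::'h::chilbert_space)"
  by (subst (1 2 3) cinner_commute) (simp add: cinner_add_left)

lemma cinner_scaleC_right: "cinner x (a *\<^sub>C y) = cnj a * cinner x (y::'h::chilbert_space)"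
  by (subst (1 2) cinner_commute) (simp add: cinner_scaleC_left)

lemma cinner_scaleR_left: "cinner (r *\<^sub>R x) y = complex_of_real r * cinner x (y::'h::chilbert_space)"
  by (simp add: cinner_scaleC_left flip: scaleC_complex_of_real)

lemma cinner_scaleR_right: "cinner x (r *\<^sub>R y) = complex_of_real r * cinner x (y::'h::chilbert_space)"
  by (simp add: cinner_scaleC_right flip: scaleC_complex_of_real)

lemma cinner_zero [simp]: "cinner 0 y = 0" "cinner x (0::'h::chilbert_space) = 0"
  using cinner_scaleR_left[of 0 0 y] cinner_scaleR_right[of x 0 0] by simp_all

lemma cinner_minus [simp]:
  "cinner (- x) y = - cinner x y" "cinner x (- y) = - cinner x (y::'h::chilbert_space)"
  using cinner_scaleR_left[of "-1" x y] cinner_scaleR_right[of x "-1" y] by simp_all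

lemma cinner_diff:
  "cinner (x - y) z = cinner x z - cinner y z"
  "cinner z (x - y) = cinner z x - cinner z (y::'h::chilbert_space)"
  using cinner_add_left[of x "- y" z] cinner_add_right[of z x "- y"] by simp_all

lemma cinner_sum_left: "cinner (sum f A) y = (\<Sum>i\<in>A. cinner (f i) (y::'h::chilbert_space))"
  by (induction A rule: infinite_finite_induct) (simp_all add: cinner_add_left)

lemma cinner_sum_right: "cinner x (sum f A) = (\<Sum>i\<in>A. cinner x (f i :: 'h::chilbert_space))"
  by (induction A rule: infinite_finite_induct) (simp_all add: cinner_add_right)

lemma cinner_right_eqI:
  fixes y z :: "'h::chilbert_space"
  assumes "\<And>x. cinner x y = cinner x z"
  shows "y = z"
proof -
  have "cinner (y - z) (y - z) = 0"
    using assms[of "y - z"] by (simp add: cinner_diff(2))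
  then show ?thesis
    by (simp add: cinner_self)
qed

lemma norm_add_square:
  "(norm (x + y))\<^sup>2 = (norm x)\<^sup>2 + 2 * Re (cinner x y) + (norm (y::'h::chilbert_space))\<^sup>2"
proof -
  have "complex_of_real ((norm (x + y))\<^sup>2)
      = of_real ((norm x)\<^sup>2) + (cinner x y + cinner y x) + of_real ((norm y)\<^sup>2)"
    by (simp add: cinner_add_left cinner_add_right cinner_self[symmetric] del: of_real_power)
  also have "cinner x y + cinner y x = of_real (2 * Re (cinner x y))"
    by (subst (2) cinner_commute) (rule complex_add_cnj)
  finally show ?thesis
    by (simp only: flip: of_real_add) (simp only: of_real_eq_iff)
qed

lemma Re_cinner_le: "Re (cinner x y) \<le> norm x * norm (y::'h::chilbert_space)"
proof -
  have "(norm (x + y))\<^sup>2 \<le> (norm x + norm y)\<^sup>2"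
    by (simp add: norm_triangle_ineq power_mono)
  then show ?thesis
    by (simp add: norm_add_square power2_sum)
qed

lemma parallelogram_law:
  fixes x y :: "'h::chilbert_space"
  shows "(norm (x + y))\<^sup>2 + (norm (x - y))\<^sup>2 = 2 * (norm x)\<^sup>2 + 2 * (norm y)\<^sup>2"
  using norm_add_square[of x y] norm_add_square[of x "- y"] by simp

text \<open>
  The representing vector is the minimiser of \<open>J x = (norm x)\<^sup>2 - 2 * r x\<close>.  By the parallelogram
  law almost minimal points are close to each other, so completeness provides a minimiser \<open>z\<close>, and
  the first variation of \<open>J\<close> at \<open>z\<close> is \<open>Re (cinner x z) - r x\<close> up to a factor.
\<close>

lemma Riesz_representation_real:
  fixes r :: "'h::chilbert_space \<Rightarrow> real"
  assumes "bounded_linear r"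
  obtains z where "\<And>x. r x = Re (cinner x z)"
proof -
  interpret r: bounded_linear r by fact
  define J where "J x = (norm x)\<^sup>2 - 2 * r x" for x
  obtain K where K: "\<And>x. norm (r x) \<le> norm x * K"
    using r.bounded by blast
  have lower: "J x \<ge> - K\<^sup>2" for x
    using K[of x] sum_squares_ge_zero[of "norm x - K" 0]
    by (simp add: J_def power2_eq_square algebra_simps)
  have bdd: "bdd_below (range J)"
    using lower by (intro bdd_belowI2)
  define m where "m = Inf (range J)"
  have m: "m \<le> J x" for x
    unfolding m_def using bdd by (rule cINF_lower) simp
  define S where "S n = {x. J x \<le> m + inverse (real (Suc n))}" for n
  have cont: "continuous_on UNIV J"
    unfolding J_def by (intro continuous_intros r.continuous_on)
  have "\<exists>z. \<forall>n. z \<in> S n"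
  proof (rule decreasing_closed_nest[of S])
    show "closed (S n)" for n
      unfolding S_def using cont by (intro closed_Collect_le) auto
    show "S n \<noteq> {}" for n
    proof -
      have "Inf (range J) < m + inverse (real (Suc n))"
        by (simp add: m_def)
      then obtain x where "J x < m + inverse (real (Suc n))"
        using bdd by (subst (asm) cInf_less_iff) auto
      then show ?thesis
        by (auto simp: S_def intro!: less_imp_le)
    qed
    show "S n \<subseteq> S k" if "k \<le> n" for k n
    proof -
      have "inverse (real (Suc n)) \<le> inverse (real (Suc k))"
        using that by (simp add: le_imp_inverse_le)
      then show ?thesis
        unfolding S_def by (intro Collect_mono) (metis add_left_mono order_trans)
    qed
    show "\<exists>n. \<forall>x\<in>S n. \<forall>y\<in>S n. dist x y < e" if "e > 0" for e :: real
    proof -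
      obtain n where n: "inverse (real (Suc n)) < e\<^sup>2 / 4"
        using reals_Archimedean[of "e\<^sup>2 / 4"] \<open>e > 0\<close> by auto
      have "dist x y < e" if "x \<in> S n" "y \<in> S n" for x y
      proof -
        \<comment> \<open>\<open>J\<close> at the midpoint of \<open>x\<close> and \<open>y\<close> is at least \<open>m\<close>.\<close>
        have "4 * J ((1/2) *\<^sub>R (x + y)) = (norm (x + y))\<^sup>2 - 4 * r x - 4 * r y"
          by (simp add: J_def r.scaleR r.add power2_eq_square add_divide_distrib)
        then have "(norm (x - y))\<^sup>2 = 2 * J x + 2 * J y - 4 * J ((1/2) *\<^sub>R (x + y))"
          using parallelogram_law[of x y] by (simp add: J_def)
        also have "\<dots> < e\<^sup>2"
          using m[of "(1/2) *\<^sub>R (x + y)"] that n by (simp add: S_def)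
        finally show ?thesis
          using \<open>e > 0\<close> by (simp add: dist_norm power_less_imp_less_base)
      qed
      then show ?thesis by blast
    qed
    show "\<exists>z. \<forall>n. z \<in> S n" if "\<And>n. a \<in> S n" for a
      using that by blast
  qed
  then obtain z where z: "\<And>n. z \<in> S n"
    by blast
  have "J z \<le> m"
  proof (rule field_le_epsilon)
    fix e :: real assume "e > 0"
    then obtain n where "inverse (real (Suc n)) < e"
      using reals_Archimedean by blast
    then show "J z \<le> m + e"
      using z[of n] by (simp add: S_def)
  qed
  have "r x = Re (cinner x z)" for x
  proof -
    define d where "d = Re (cinner x z) - r x"
    have expand: "J (z + t *\<^sub>R x) = J z + 2 * t * d + t\<^sup>2 * (norm x)\<^sup>2" for t
    proof -
      have "Re (cinner z x) = Re (cinner x z)"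
        by (subst cinner_commute) simp
      then show ?thesis
        by (simp add: J_def d_def norm_add_square cinner_scaleR_right r.add r.scaleR
            power_mult_distrib algebra_simps)
    qed
    have quad: "0 \<le> 2 * t * d + t\<^sup>2 * (norm x)\<^sup>2" for t
      using \<open>J z \<le> m\<close> m[of "z + t *\<^sub>R x"] expand[of t] by linarith
    \<comment> \<open>A step against the sign of \<open>d\<close>, short enough for the linear term to dominate.\<close>
    define c where "c = 1 + (norm x)\<^sup>2"
    have "c > 0"
      by (simp add: c_def add_pos_nonneg)
    have "0 \<le> 2 * (- d / c) * d + (- d / c)\<^sup>2 * (c - 1)"
      using quad[of "- d / c"] by (simp add: c_def)
    also have "\<dots> = - (d\<^sup>2 * (c + 1)) / c\<^sup>2"
      using \<open>c > 0\<close> by (simp add: field_simps power2_eq_square)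
    finally have "d\<^sup>2 * (c + 1) \<le> 0"
      using \<open>c > 0\<close> by (simp add: divide_le_0_iff zero_le_divide_iff)
    then have "d = 0"
      using \<open>c > 0\<close> by (simp add: mult_le_0_iff)
    then show ?thesis by (simp add: d_def)
  qed
  then show thesis by (rule that)
qed

lemma cinner_cadjoint:
  assumes "f \<in> bounded_ops"
  shows "cinner (f x) y = cinner x (cadjoint f y)"
proof -
  have lin: "bounded_linear f" and scale: "\<And>a x. f (a *\<^sub>C x) = a *\<^sub>C f x"
    using assms by (auto simp: bounded_ops_def)
  interpret f: bounded_linear f by fact
  have "\<exists>z. \<forall>x. cinner (f x) y = cinner x z" for y
  proof -
    obtain K where K: "\<And>x. norm (f x) \<le> norm x * K"
      using f.bounded by blast
    have bound: "\<bar>Re (cinner (f x) y)\<bar> \<le> norm x * (K * norm y)" for x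
    proof -
      have "\<bar>Re (cinner (f x) y)\<bar> \<le> norm (f x) * norm y"
        using Re_cinner_le[of "f x" y] Re_cinner_le[of "- f x" y] by simp
      also have "\<dots> \<le> norm x * K * norm y"
        by (intro mult_right_mono K) simp
      finally show ?thesis by (simp add: mult.assoc)
    qed
    have "bounded_linear (\<lambda>x. Re (cinner (f x) y))"
      by (rule bounded_linear_intro[where K = "K * norm y"])
        (use bound in \<open>simp_all add: f.add f.scaleR cinner_add_left cinner_scaleR_left\<close>)
    then obtain z where z: "\<And>x. Re (cinner (f x) y) = Re (cinner x z)"
      using Riesz_representation_real by blast
    \<comment> \<open>The imaginary part of a functional at \<open>x\<close> is minus its real part at \<open>\<i> *\<^sub>C x\<close>.\<close>
    have "Im (cinner (f x) y) = Im (cinner x z)" for x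
      using z[of "\<i> *\<^sub>C x"] by (simp add: scale cinner_scaleC_left)
    with z show ?thesis by (auto simp: complex_eq_iff)
  qed
  then have "\<exists>f'. \<forall>x y. cinner (f x) y = cinner x (f' y)"
    by metis
  then have "\<forall>x y. cinner (f x) y = cinner x (cadjoint f y)"
    unfolding cadjoint_def by (rule someI_ex)
  then show ?thesis by blast
qed

lemma cinner_cadjoint_left:
  assumes "f \<in> bounded_ops"
  shows "cinner (cadjoint f x) y = cinner x (f y)"
  by (subst (1 2) cinner_commute) (simp add: cinner_cadjoint[OF assms])

lemma cadjoint_bounded_ops:
  assumes "f \<in> bounded_ops"
  shows "cadjoint f \<in> bounded_ops"
proof -
  note adj = cinner_cadjoint[OF assms, symmetric]
  have add: "cadjoint f (x + y) = cadjoint f x + cadjoint f y" for x y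
    by (rule cinner_right_eqI) (simp add: adj cinner_add_right)
  have scale: "cadjoint f (a *\<^sub>C x) = a *\<^sub>C cadjoint f x" for a x
    by (rule cinner_right_eqI) (simp add: adj cinner_scaleC_right)
  obtain K where K: "\<And>x. norm (f x) \<le> norm x * K"
    using assms bounded_linear.bounded by (force simp: bounded_ops_def)
  have "norm (cadjoint f y) \<le> norm y * K" for y
  proof (cases "cadjoint f y = 0")
    case True
    then show ?thesis
      using K[of y] norm_ge_zero order_trans by (metis norm_zero)
  next
    case False
    have "(norm (cadjoint f y))\<^sup>2 = Re (cinner (f (cadjoint f y)) y)"
      by (simp add: cinner_cadjoint[OF assms] cinner_self)
    also have "\<dots> \<le> norm (f (cadjoint f y)) * norm y"
      by (rule Re_cinner_le)
    also have "\<dots> \<le> norm (cadjoint f y) * K * norm y"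
      by (intro mult_right_mono K) simp
    finally show ?thesis
      using False by (simp add: power2_eq_square mult.assoc mult.commute)
  qed
  then have "bounded_linear (cadjoint f)"
    by (intro bounded_linear_intro[where K = K])
      (simp_all add: add scale flip: scaleC_complex_of_real)
  with scale show ?thesis by (simp add: bounded_ops_def)
qed

lemma bounded_ops_comp: "f \<in> bounded_ops \<Longrightarrow> g \<in> bounded_ops \<Longrightarrow> f \<circ> g \<in> bounded_ops"
  by (auto simp: bounded_ops_def comp_def intro: bounded_linear_compose)

lemma bounded_ops_apply:
  assumes "f \<in> bounded_ops"
  shows "f 0 = 0" "f (- x) = - f x"
proof -
  interpret bounded_linear f
    using assms by (simp add: bounded_ops_def)
  show "f 0 = 0" "f (- x) = - f x"
    by (rule zero neg)+
qed

section \<open>Disjoint elements of a lattice ordered group\<close>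

context lattice_ordered_group
begin

text \<open>
  Membership in the carrier is part of the relation, so that it need not be assumed separately.
\<close>

definition cone_le :: "'a \<Rightarrow> 'a \<Rightarrow> bool" (infix "\<preceq>" 50) where
  "x \<preceq> y \<longleftrightarrow> x \<in> carrier G \<and> y \<in> carrier G \<and> inv x \<otimes> y \<in> P"

lemma cone_le_carrier: "x \<preceq> y \<Longrightarrow> x \<in> carrier G" "x \<preceq> y \<Longrightarrow> y \<in> carrier G"
  by (simp_all add: cone_le_def)

lemma cone_carrier: "p \<in> P \<Longrightarrow> p \<in> carrier G"
  using cone_subset by blast

lemma cone_le_refl: "x \<in> carrier G \<Longrightarrow> x \<preceq> x"
  by (simp add: cone_le_def one_in_cone)

lemma one_cone_le_iff: "\<one> \<preceq> x \<longleftrightarrow> x \<in> P"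
  using cone_subset by (auto simp: cone_le_def)

lemma mult_inv_cancel:
  assumes "a \<in> carrier G" "x \<in> carrier G"
  shows "a \<otimes> (inv a \<otimes> x) = x" "inv a \<otimes> (a \<otimes> x) = x"
  using assms by (simp_all flip: m_assoc)

lemma cone_le_trans: assumes "x \<preceq> y" "y \<preceq> z" shows "x \<preceq> z"
proof -
  have "inv x \<otimes> z = (inv x \<otimes> y) \<otimes> (inv y \<otimes> z)"
    using assms by (simp add: cone_le_def m_assoc mult_inv_cancel)
  then show ?thesis
    using assms by (simp add: cone_le_def cone_mult_closed)
qed

lemma cone_le_antisym: assumes "x \<preceq> y" "y \<preceq> x" shows "x = y"
proof -
  have c: "x \<in> carrier G" "y \<in> carrier G" "inv x \<otimes> y \<in> P" "inv y \<otimes> x \<in> P"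
    using assms by (auto simp: cone_le_def)
  then have "inv x \<otimes> y = inv (inv y \<otimes> x)"
    by (simp add: inv_mult_group)
  with c have "inv x \<otimes> y \<in> P \<inter> set_inv P"
    by (auto simp: SET_INV_def)
  then have "inv x \<otimes> y = \<one>"
    using cone_pointed by simp
  with c show ?thesis
    by (metis inv_closed inv_equality inv_inv)
qed

lemma cone_le_left_cancel:
  assumes "a \<in> carrier G" "x \<in> carrier G" "y \<in> carrier G"
  shows "a \<otimes> x \<preceq> a \<otimes> y \<longleftrightarrow> x \<preceq> y"
proof -
  have "inv (a \<otimes> x) \<otimes> (a \<otimes> y) = inv x \<otimes> y"
    using assms by (simp add: inv_mult_group m_assoc mult_inv_cancel)
  then show ?thesis
    using assms by (simp add: cone_le_def)
qed

lemma cone_le_right_mono: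
  assumes "a \<in> carrier G" "x \<preceq> y"
  shows "x \<otimes> a \<preceq> y \<otimes> a"
proof -
  have c: "x \<in> carrier G" "y \<in> carrier G" "inv x \<otimes> y \<in> P"
    using assms by (auto simp: cone_le_def)
  have "inv (x \<otimes> a) \<otimes> (y \<otimes> a) = inv a \<otimes> (inv x \<otimes> y) \<otimes> inv (inv a)"
    using assms c by (simp add: inv_mult_group m_assoc)
  also have "\<dots> \<in> inv a <# P #> inv (inv a)"
    using c by (auto simp: l_coset_def r_coset_def)
  also have "\<dots> \<subseteq> P"
    using assms by (intro cone_conj) simp
  finally show ?thesis
    using assms c by (simp add: cone_le_def)
qed

lemma cone_le_right_cancel:
  assumes "a \<in> carrier G" "x \<in> carrier G" "y \<in> carrier G"
  shows "x \<otimes> a \<preceq> y \<otimes> a \<longleftrightarrow> x \<preceq> y"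
  using cone_le_right_mono[of "inv a" "x \<otimes> a" "y \<otimes> a"] cone_le_right_mono[of a x y] assms
  by (auto simp: m_assoc)

lemma cone_le_mult_iff:
  assumes "a \<in> carrier G" "x \<in> carrier G" "y \<in> carrier G"
  shows "x \<otimes> inv a \<preceq> y \<longleftrightarrow> x \<preceq> y \<otimes> a" "x \<preceq> y \<otimes> inv a \<longleftrightarrow> x \<otimes> a \<preceq> y"
    "inv a \<otimes> x \<preceq> y \<longleftrightarrow> x \<preceq> a \<otimes> y" "x \<preceq> inv a \<otimes> y \<longleftrightarrow> a \<otimes> x \<preceq> y"
  using cone_le_right_cancel[of a "x \<otimes> inv a" y] cone_le_right_cancel[of a x "y \<otimes> inv a"]
    cone_le_left_cancel[of a "inv a \<otimes> x" y] cone_le_left_cancel[of a x "inv a \<otimes> y"] assms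
  by (simp_all add: m_assoc mult_inv_cancel)

lemma inv_cone_le: assumes "x \<preceq> y" shows "inv y \<preceq> inv x"
proof -
  have c: "x \<in> carrier G" "y \<in> carrier G"
    using assms by (auto simp: cone_le_def)
  then have "\<one> \<preceq> inv x \<otimes> y"
    using assms by (simp add: cone_le_mult_iff)
  then show ?thesis
    using c cone_le_mult_iff(1)[of y \<one> "inv x"] by simp
qed

lemma join_lub:
  assumes "x \<in> carrier G" "y \<in> carrier G"
  shows "x \<preceq> x \<squnion>\<^bsub>cone_order G P\<^esub> y" "y \<preceq> x \<squnion>\<^bsub>cone_order G P\<^esub> y"
    and "x \<preceq> z \<Longrightarrow> y \<preceq> z \<Longrightarrow> x \<squnion>\<^bsub>cone_order G P\<^esub> y \<preceq> z"
proof -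
  let ?L = "cone_order G P"
  have "least ?L (x \<squnion>\<^bsub>?L\<^esub> y) (Upper ?L {x, y})"
    unfolding join_def sup_def using join_exists[OF assms] by (rule someI_ex)
  then show "x \<preceq> x \<squnion>\<^bsub>?L\<^esub> y" "y \<preceq> x \<squnion>\<^bsub>?L\<^esub> y"
    and "x \<preceq> z \<Longrightarrow> y \<preceq> z \<Longrightarrow> x \<squnion>\<^bsub>?L\<^esub> y \<preceq> z"
    using assms by (auto simp: least_def Upper_def cone_order_def cone_le_def)
qed

lemma meet_glb:
  assumes "x \<in> carrier G" "y \<in> carrier G"
  shows "x \<sqinter>\<^bsub>cone_order G P\<^esub> y \<preceq> x" "x \<sqinter>\<^bsub>cone_order G P\<^esub> y \<preceq> y"
    and "z \<preceq> x \<Longrightarrow> z \<preceq> y \<Longrightarrow> z \<preceq> x \<sqinter>\<^bsub>cone_order G P\<^esub> y"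
proof -
  let ?L = "cone_order G P"
  have "greatest ?L (x \<sqinter>\<^bsub>?L\<^esub> y) (Lower ?L {x, y})"
    unfolding meet_def inf_def using meet_exists[OF assms] by (rule someI_ex)
  then show "x \<sqinter>\<^bsub>?L\<^esub> y \<preceq> x" "x \<sqinter>\<^bsub>?L\<^esub> y \<preceq> y"
    and "z \<preceq> x \<Longrightarrow> z \<preceq> y \<Longrightarrow> z \<preceq> x \<sqinter>\<^bsub>?L\<^esub> y"
    using assms by (auto simp: greatest_def Lower_def cone_order_def cone_le_def)
qed

definition disjoint :: "'a \<Rightarrow> 'a \<Rightarrow> bool" where
  "disjoint a b \<longleftrightarrow> a \<in> P \<and> b \<in> P \<and> (\<forall>x. x \<preceq> a \<longrightarrow> x \<preceq> b \<longrightarrow> x \<preceq> \<one>)"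

lemma disjointD: "disjoint a b \<Longrightarrow> x \<preceq> a \<Longrightarrow> x \<preceq> b \<Longrightarrow> x \<preceq> \<one>"
  by (simp add: disjoint_def)

lemma disjoint_cone: "disjoint a b \<Longrightarrow> a \<in> P" "disjoint a b \<Longrightarrow> b \<in> P"
  by (simp_all add: disjoint_def)

lemma disjoint_sym: "disjoint a b \<Longrightarrow> disjoint b a"
  by (auto simp: disjoint_def)

lemma meet_eq_one_iff_disjoint:
  assumes "a \<in> P" "b \<in> P"
  shows "a \<sqinter>\<^bsub>cone_order G P\<^esub> b = \<one> \<longleftrightarrow> disjoint a b"
proof
  note c = cone_carrier[OF assms(1)] cone_carrier[OF assms(2)]
  note glb = meet_glb[OF c]
  show "disjoint a b" if "a \<sqinter>\<^bsub>cone_order G P\<^esub> b = \<one>"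
    using assms glb(3) that by (auto simp: disjoint_def)
  show "a \<sqinter>\<^bsub>cone_order G P\<^esub> b = \<one>" if "disjoint a b"
    using assms glb(1,2) glb(3)[of \<one>] that
    by (intro cone_le_antisym) (auto simp: disjoint_def one_cone_le_iff)
qed

lemma disjoint_mono:
  assumes "disjoint a b" "c \<preceq> a" "c \<in> P"
  shows "disjoint c b"
  using assms cone_le_trans by (auto simp: disjoint_def)

text \<open>
  The product of disjoint elements is their join: \<open>a z\<^sup>-\<^sup>1 b\<close> lies below \<open>a\<close> and below \<open>b\<close>
  whenever \<open>z\<close> lies above both, so it lies below the identity.
\<close>

lemma disjoint_mult_le:
  assumes "disjoint a b" "a \<preceq> z" "b \<preceq> z"
  shows "b \<otimes> a \<preceq> z"
proof -
  have c: "a \<in> carrier G" "b \<in> carrier G" "z \<in> carrier G"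
    using assms by (auto simp: cone_le_def)
  have "a \<otimes> (inv z \<otimes> b) \<preceq> a \<otimes> \<one>"
    using c assms by (subst cone_le_left_cancel) (simp_all add: cone_le_mult_iff)
  moreover have "(a \<otimes> inv z) \<otimes> b \<preceq> \<one> \<otimes> b"
    using c assms by (subst cone_le_right_cancel) (simp_all add: cone_le_mult_iff)
  ultimately have "a \<otimes> (inv z \<otimes> b) \<preceq> \<one>"
    using c by (intro disjointD[OF assms(1)]) (simp_all add: m_assoc)
  then have "inv z \<otimes> b \<preceq> inv a"
    using c cone_le_mult_iff(4)[of a "inv z \<otimes> b" \<one>] by simp
  then have "b \<preceq> z \<otimes> inv a"
    using c by (simp add: cone_le_mult_iff)
  then show ?thesis
    using c by (simp add: cone_le_mult_iff)
qed

lemma disjoint_commute: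
  assumes "disjoint a b"
  shows "a \<otimes> b = b \<otimes> a"
proof -
  have P: "a \<in> P" "b \<in> P"
    using assms by (auto simp: disjoint_def)
  have le: "a \<preceq> a \<otimes> b \<and> b \<preceq> a \<otimes> b" if "a \<in> P" "b \<in> P" for a b
    using that cone_carrier cone_le_left_cancel[of a \<one> b] cone_le_right_cancel[of b \<one> a]
    by (simp add: one_cone_le_iff)
  show ?thesis
    using assms P le[of a b] le[of b a] disjoint_sym
    by (intro cone_le_antisym) (auto intro: disjoint_mult_le)
qed

text \<open>
  A common lower bound \<open>x\<close> of \<open>a b\<close> and \<open>c\<close> gives the common lower bound \<open>a\<^sup>-\<^sup>1 x\<close> of \<open>b\<close> and
  \<open>c\<close>, whence \<open>x\<close> lies below \<open>a\<close> as well.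
\<close>

lemma disjoint_mult:
  assumes "disjoint a c" "disjoint b c"
  shows "disjoint (a \<otimes> b) c"
proof -
  have P: "a \<in> P" "b \<in> P" "c \<in> P"
    using assms by (auto simp: disjoint_def)
  have "x \<preceq> \<one>" if x: "x \<preceq> a \<otimes> b" "x \<preceq> c" for x
  proof -
    have c: "a \<in> carrier G" "b \<in> carrier G" "x \<in> carrier G"
      using P x cone_carrier by (auto simp: cone_le_def)
    have "inv a \<otimes> x \<preceq> b"
      using c x by (simp add: cone_le_mult_iff)
    moreover have "inv a \<otimes> x \<preceq> c"
    proof (rule cone_le_trans[OF _ x(2)])
      show "inv a \<otimes> x \<preceq> x"
        using c P cone_le_right_mono[of x \<one> a] by (simp add: cone_le_mult_iff one_cone_le_iff)
    qed
    ultimately have "inv a \<otimes> x \<preceq> \<one>"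
      using assms(2) by (rule disjointD[rotated])
    then have "x \<preceq> a"
      using c by (simp add: cone_le_mult_iff)
    then show ?thesis
      using x(2) by (rule disjointD[OF assms(1)])
  qed
  then show ?thesis
    using P by (simp add: disjoint_def cone_mult_closed)
qed

lemma pos_neg_part_lub:
  assumes "x \<in> carrier G"
  shows "x \<preceq> pos_part G P x" "pos_part G P x \<in> P"
    "\<lbrakk>x \<preceq> z; z \<in> P\<rbrakk> \<Longrightarrow> pos_part G P x \<preceq> z"
    "inv x \<preceq> neg_part G P x" "neg_part G P x \<in> P"
    "\<lbrakk>inv x \<preceq> z; z \<in> P\<rbrakk> \<Longrightarrow> neg_part G P x \<preceq> z"
  using join_lub[of x \<one>] join_lub[of "inv x" \<one>] assms
  by (simp_all add: pos_part_def neg_part_def one_cone_le_iff)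

lemma neg_part_inv: "x \<in> carrier G \<Longrightarrow> neg_part G P (inv x) = pos_part G P x"
  by (simp add: pos_part_def neg_part_def)

lemma pos_part_inv: "pos_part G P (inv x) = neg_part G P x"
  by (simp add: pos_part_def neg_part_def)

text \<open>
  Uniqueness of the decomposition into disjoint parts: an upper bound \<open>z\<close> of \<open>a b\<^sup>-\<^sup>1\<close> and the
  identity makes \<open>z b\<close> an upper bound of \<open>a\<close> and \<open>b\<close>, hence of \<open>a b\<close>.
\<close>

lemma pos_part_of_disjoint:
  assumes "disjoint a b"
  shows "pos_part G P (a \<otimes> inv b) = a"
proof -
  have P: "a \<in> P" "b \<in> P"
    using assms by (auto simp: disjoint_def)
  note c = P[THEN cone_carrier]
  have x: "a \<otimes> inv b \<in> carrier G"
    using c by simp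
  have "a \<otimes> inv b \<preceq> a"
    using c P cone_le_left_cancel[of a \<one> b] by (simp add: cone_le_mult_iff one_cone_le_iff)
  then have "pos_part G P (a \<otimes> inv b) \<preceq> a"
    using x P by (intro pos_neg_part_lub) simp_all
  moreover have "a \<preceq> z" if z: "a \<otimes> inv b \<preceq> z" "z \<in> P" for z
  proof -
    have cz: "z \<in> carrier G"
      using z cone_carrier by blast
    have "b \<preceq> z \<otimes> b"
      using z cz c cone_le_right_mono[of b \<one> z] by (simp add: one_cone_le_iff)
    moreover have "a \<preceq> z \<otimes> b"
      using z cz c by (simp add: cone_le_mult_iff)
    ultimately have "a \<otimes> b \<preceq> z \<otimes> b"
      by (intro disjoint_mult_le disjoint_sym[OF assms])
    then show ?thesis
      using c cz by (simp add: cone_le_right_cancel)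
  qed
  ultimately show ?thesis
    using pos_neg_part_lub(1,2)[OF x] by (intro cone_le_antisym) simp_all
qed

lemma neg_part_of_disjoint:
  assumes "disjoint a b"
  shows "neg_part G P (a \<otimes> inv b) = b"
proof -
  have c: "a \<in> carrier G" "b \<in> carrier G"
    using disjoint_cone[OF assms] cone_carrier by auto
  have "neg_part G P (a \<otimes> inv b) = pos_part G P (b \<otimes> inv a)"
    using c by (simp add: inv_mult_group flip: pos_part_inv)
  then show ?thesis
    using pos_part_of_disjoint[OF disjoint_sym[OF assms]] by simp
qed

text \<open>
  Left translation by \<open>x\<close> carries the join of \<open>x\<^sup>-\<^sup>1\<close> and the identity to the join of the identity
  and \<open>x\<close>.
\<close>

lemma pos_part_eq_mult_neg_part:
  assumes "x \<in> carrier G"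
  shows "pos_part G P x = x \<otimes> neg_part G P x"
proof (rule cone_le_antisym)
  note lub = pos_neg_part_lub[OF assms]
  have c: "pos_part G P x \<in> carrier G" "neg_part G P x \<in> carrier G"
    using lub(2,5) cone_carrier by auto
  have "x \<preceq> x \<otimes> neg_part G P x"
    using assms c lub(5) cone_le_left_cancel[of x \<one> "neg_part G P x"]
    by (simp add: one_cone_le_iff)
  moreover have "\<one> \<preceq> x \<otimes> neg_part G P x"
    using assms c lub(4) cone_le_mult_iff(3)[of x \<one> "neg_part G P x"] by simp
  ultimately show "pos_part G P x \<preceq> x \<otimes> neg_part G P x"
    by (simp add: lub(3) one_cone_le_iff)
  have "neg_part G P x \<preceq> inv x \<otimes> pos_part G P x"
  proof (rule lub(6))
    show "inv x \<preceq> inv x \<otimes> pos_part G P x"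
      using assms c lub(2) cone_le_left_cancel[of "inv x" \<one> "pos_part G P x"]
      by (simp add: one_cone_le_iff)
    have "\<one> \<preceq> inv x \<otimes> pos_part G P x"
      using assms c lub(1) by (simp add: cone_le_mult_iff)
    then show "inv x \<otimes> pos_part G P x \<in> P"
      by (simp add: one_cone_le_iff)
  qed
  then show "x \<otimes> neg_part G P x \<preceq> pos_part G P x"
    using assms c by (simp add: cone_le_mult_iff)
qed

lemma disjoint_pos_neg_part:
  assumes "x \<in> carrier G"
  shows "disjoint (pos_part G P x) (neg_part G P x)"
proof -
  note lub = pos_neg_part_lub[OF assms]
  let ?n = "neg_part G P x"
  have n: "?n \<in> carrier G"
    using lub(5) cone_carrier by auto
  have "y \<preceq> \<one>" if y: "y \<preceq> pos_part G P x" "y \<preceq> ?n" for y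
  proof -
    have c: "y \<in> carrier G"
      using y by (simp add: cone_le_def)
    have "y \<otimes> inv ?n \<preceq> x"
      using y(1) assms n c by (simp add: pos_part_eq_mult_neg_part cone_le_mult_iff)
    then have "inv x \<preceq> inv (y \<otimes> inv ?n)"
      by (rule inv_cone_le)
    then have "inv x \<preceq> ?n \<otimes> inv y"
      using n c by (simp add: inv_mult_group)
    moreover have "\<one> \<preceq> ?n \<otimes> inv y"
      using y(2) n c by (simp add: cone_le_mult_iff)
    ultimately have "?n \<preceq> ?n \<otimes> inv y"
      by (simp add: lub(6) one_cone_le_iff)
    then have "?n \<otimes> y \<preceq> ?n \<otimes> \<one>"
      using n c by (simp add: cone_le_mult_iff)
    then show ?thesis
      using n c by (subst (asm) cone_le_left_cancel) auto
  qed
  then show ?thesis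
    by (simp add: disjoint_def lub(2,5))
qed

text \<open>
  An element \<open>g\<close> disjoint from the negative part commutes with it, and
  \<open>(x\<^sub>+ g) x\<^sub>-\<^sup>-\<^sup>1\<close> is again a quotient of disjoint elements.
\<close>

lemma parts_mult_disjoint:
  assumes "x \<in> carrier G" "disjoint g (neg_part G P x)"
  shows "pos_part G P (x \<otimes> g) = pos_part G P x \<otimes> g" "neg_part G P (x \<otimes> g) = neg_part G P x"
proof -
  let ?p = "pos_part G P x" and ?n = "neg_part G P x"
  have c: "?p \<in> carrier G" "?n \<in> carrier G" "g \<in> carrier G"
    using pos_neg_part_lub[OF assms(1)] disjoint_cone[OF assms(2)] cone_carrier by auto
  have "g \<otimes> inv ?n = inv ?n \<otimes> (?n \<otimes> g) \<otimes> inv ?n"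
    using c by (simp add: m_assoc mult_inv_cancel)
  also have "\<dots> = inv ?n \<otimes> g"
    using c by (simp add: m_assoc flip: disjoint_commute[OF assms(2)])
  finally have comm: "g \<otimes> inv ?n = inv ?n \<otimes> g" .
  have "x = ?p \<otimes> inv ?n"
    using pos_part_eq_mult_neg_part[OF assms(1)] c assms(1) by (simp add: m_assoc)
  then have "x \<otimes> g = ?p \<otimes> inv ?n \<otimes> g"
    by simp
  also have "\<dots> = ?p \<otimes> g \<otimes> inv ?n"
    using c comm by (simp add: m_assoc)
  finally have eq: "x \<otimes> g = ?p \<otimes> g \<otimes> inv ?n" .
  have "disjoint (?p \<otimes> g) ?n"
    by (rule disjoint_mult[OF disjoint_pos_neg_part[OF assms(1)] assms(2)])
  then show "pos_part G P (x \<otimes> g) = ?p \<otimes> g" "neg_part G P (x \<otimes> g) = ?n"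
    by (simp_all add: eq pos_part_of_disjoint neg_part_of_disjoint)
qed

lemma neg_part_quotient_le:
  assumes "q \<in> P" "p \<in> P"
  shows "neg_part G P (q \<otimes> inv p) \<preceq> p"
proof -
  have c: "q \<in> carrier G" "p \<in> carrier G"
    using assms cone_carrier by auto
  have "p \<otimes> inv q \<preceq> p"
    using c assms cone_le_left_cancel[of p \<one> q] by (simp add: cone_le_mult_iff one_cone_le_iff)
  then show ?thesis
    using c assms by (intro pos_neg_part_lub) (simp_all add: inv_mult_group)
qed

lemma finite_upper_bound:
  assumes "finite A" "A \<subseteq> carrier G"
  shows "\<exists>h\<in>carrier G. \<forall>x\<in>A. x \<preceq> h"
  using assms
proof (induction A)
  case empty
  then show ?case by blast
next
  case (insert a A)
  then obtain h where h: "h \<in> carrier G" "\<forall>x\<in>A. x \<preceq> h" by auto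
  have a: "a \<in> carrier G"
    using insert.prems by simp
  note join = join_lub[OF a h(1)]
  show ?case
    using h join(1,2) cone_le_trans cone_le_carrier(2)[OF join(1)]
    by (intro bexI[of _ "a \<squnion>\<^bsub>cone_order G P\<^esub> h"]) blast+
qed

lemma finite_glb:
  assumes "finite A" "A \<noteq> {}" "A \<subseteq> carrier G"
  shows "\<exists>m. (\<forall>x\<in>A. m \<preceq> x) \<and> (\<forall>y. (\<forall>x\<in>A. y \<preceq> x) \<longrightarrow> y \<preceq> m)"
  using assms
proof (induction A rule: finite_ne_induct)
  case (singleton a)
  then show ?case using cone_le_refl by auto
next
  case (insert a A)
  then obtain m where m: "\<forall>x\<in>A. m \<preceq> x" "\<forall>y. (\<forall>x\<in>A. y \<preceq> x) \<longrightarrow> y \<preceq> m" by auto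
  have c: "a \<in> carrier G" "m \<in> carrier G"
    using insert.prems insert.hyps m(1) by (auto simp: cone_le_def)
  note meet = meet_glb[OF c]
  show ?case
    using m meet cone_le_trans
    by (intro exI[of _ "a \<sqinter>\<^bsub>cone_order G P\<^esub> m"]) blast
qed

end

section \<open>The form of a representation\<close>

locale contractive_lattice_representation = lattice_ordered_group +
  fixes T :: "'a \<Rightarrow> 'h \<Rightarrow> 'h::chilbert_space"
  assumes contractive_rep: "contractive_representation G P T"
begin

lemma T_bounded_ops: "p \<in> P \<Longrightarrow> T p \<in> bounded_ops"
  and T_one: "T \<one> = id"
  and T_mult: "p \<in> P \<Longrightarrow> q \<in> P \<Longrightarrow> T (p \<otimes> q) = T p \<circ> T q"
  using contractive_rep by (auto simp: contractive_representation_def)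

text \<open>
  The sesquilinear form of the operator \<open>tilde G P T x\<close>, with the adjoint moved to the second
  argument; this eliminates adjoints from the computations.
\<close>

definition tilde_form :: "'a \<Rightarrow> 'h \<Rightarrow> 'h \<Rightarrow> complex" where
  "tilde_form x u v = cinner (T (pos_part G P x) u) (T (neg_part G P x) v)"

lemma cinner_tilde:
  assumes "x \<in> carrier G"
  shows "cinner (tilde G P T x u) v = tilde_form x u v"
  using pos_neg_part_lub(5)[OF assms] T_bounded_ops
  by (simp add: tilde_def tilde_form_def cinner_cadjoint_left)

lemma tilde_bounded_ops:
  assumes "x \<in> carrier G"
  shows "tilde G P T x \<in> bounded_ops"
  unfolding tilde_def using pos_neg_part_lub(2,5)[OF assms] T_bounded_ops
  by (intro bounded_ops_comp cadjoint_bounded_ops) auto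

lemma tilde_form_inv:
  assumes "x \<in> carrier G"
  shows "tilde_form (inv x) u v = cnj (tilde_form x v u)"
  unfolding tilde_form_def pos_part_inv neg_part_inv[OF assms] by (rule cinner_commute)

lemma tilde_form_one: "tilde_form \<one> u v = cinner u v"
proof -
  have "disjoint \<one> \<one>"
    by (simp add: disjoint_def one_in_cone)
  then show ?thesis
    using pos_part_of_disjoint[of \<one> \<one>] neg_part_of_disjoint[of \<one> \<one>]
    by (simp add: tilde_form_def T_one)
qed

lemma tilde_one: "tilde G P T \<one> = id"
proof
  fix u
  have "cinner v (tilde G P T \<one> u) = cinner v u" for v
    by (subst (1 2) cinner_commute) (simp add: cinner_tilde tilde_form_one)
  then show "tilde G P T \<one> u = id u"
    by (auto intro: cinner_right_eqI)
qed

lemma tilde_form_zero [simp]: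
  assumes "x \<in> carrier G"
  shows "tilde_form x 0 v = 0" "tilde_form x u 0 = 0"
  using pos_neg_part_lub(2,5)[OF assms] T_bounded_ops
  by (simp_all add: tilde_form_def bounded_ops_apply)

lemma tilde_form_minus [simp]:
  assumes "x \<in> carrier G"
  shows "tilde_form x (- u) v = - tilde_form x u v" "tilde_form x u (- v) = - tilde_form x u v"
  using pos_neg_part_lub(2,5)[OF assms] T_bounded_ops
  by (simp_all add: tilde_form_def bounded_ops_apply)

text \<open>
  A factor disjoint from the denominator of a quotient of positive elements enters only its positive
  part, because the negative part of \<open>q p\<^sup>-\<^sup>1\<close> lies below \<open>p\<close>.
\<close>

lemma tilde_form_mult_disjoint:
  assumes "q \<in> P" "disjoint g p"
  shows "tilde_form (q \<otimes> g \<otimes> inv p) u v = tilde_form (q \<otimes> inv p) (T g u) v"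
    and "tilde_form (p \<otimes> inv (q \<otimes> g)) u v = tilde_form (p \<otimes> inv q) u (T g v)"
proof -
  have P: "g \<in> P" "p \<in> P"
    using disjoint_cone[OF assms(2)] by auto
  have c: "q \<in> carrier G" "g \<in> carrier G" "p \<in> carrier G"
    using P assms(1) cone_carrier by auto
  let ?x = "q \<otimes> inv p"
  have x: "?x \<in> carrier G"
    using c by simp
  have "g \<otimes> inv p = inv p \<otimes> (p \<otimes> g) \<otimes> inv p"
    using c by (simp add: m_assoc mult_inv_cancel)
  also have "\<dots> = inv p \<otimes> g"
    using c by (simp add: m_assoc flip: disjoint_commute[OF assms(2)])
  finally have eq: "q \<otimes> g \<otimes> inv p = ?x \<otimes> g"
    using c by (simp add: m_assoc)
  have "disjoint (neg_part G P ?x) g"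
    using disjoint_sym[OF assms(2)] neg_part_quotient_le[OF assms(1) P(2)] pos_neg_part_lub(5)[OF x]
    by (rule disjoint_mono)
  then have "disjoint g (neg_part G P ?x)"
    by (rule disjoint_sym)
  then show *: "tilde_form (q \<otimes> g \<otimes> inv p) u v = tilde_form ?x (T g u) v" for u v
    using x P pos_neg_part_lub(2)[OF x]
    by (simp add: eq tilde_form_def parts_mult_disjoint T_mult)
  have "tilde_form (p \<otimes> inv (q \<otimes> g)) u v = cnj (tilde_form (q \<otimes> g \<otimes> inv p) v u)"
    using c by (simp add: inv_mult_group m_assoc flip: tilde_form_inv)
  also have "\<dots> = tilde_form (p \<otimes> inv q) u (T g v)"
    using c by (simp add: * inv_mult_group flip: tilde_form_inv)
  finally show "tilde_form (p \<otimes> inv (q \<otimes> g)) u v = tilde_form (p \<otimes> inv q) u (T g v)" .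
qed

definition quad_form :: "nat \<Rightarrow> (nat \<Rightarrow> 'a) \<Rightarrow> (nat \<Rightarrow> 'h) \<Rightarrow> complex" where
  "quad_form n p u = (\<Sum>i<n. \<Sum>j<n. tilde_form (p i \<otimes> inv (p j)) (u j) (u i))"

lemma op_matrix_nonneg_tilde_iff:
  assumes "\<And>i j. i < n \<Longrightarrow> j < n \<Longrightarrow> x i j \<in> carrier G"
  shows "op_matrix_nonneg n (\<lambda>i j. tilde G P T (x i j)) \<longleftrightarrow>
    (\<forall>u. 0 \<le> (\<Sum>i<n. \<Sum>j<n. tilde_form (x i j) (u j) (u i)))"
  using assms
  by (simp add: op_matrix_nonneg_def op_matrix_apply_def cinner_pow_def cinner_sum_left cinner_tilde)

lemma op_matrix_le_iff:
  assumes "\<And>i. i < n \<Longrightarrow> p i \<in> carrier G" "g \<in> P"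
  shows "op_matrix_le n (\<lambda>i j. cadjoint (T g) \<circ> tilde G P T (p i \<otimes> inv (p j)) \<circ> T g)
      (\<lambda>i j. tilde G P T (p i \<otimes> inv (p j))) \<longleftrightarrow>
    (\<forall>u. quad_form n p (\<lambda>i. T g (u i)) \<le> quad_form n p u)"
proof -
  have "cinner_pow n (op_matrix_apply n (\<lambda>i j h. tilde G P T (p i \<otimes> inv (p j)) h -
      (cadjoint (T g) \<circ> tilde G P T (p i \<otimes> inv (p j)) \<circ> T g) h) u) u
      = quad_form n p u - quad_form n p (\<lambda>i. T g (u i))" for u
    using assms T_bounded_ops
    by (simp add: op_matrix_apply_def cinner_pow_def cinner_sum_left cinner_diff
        cinner_cadjoint_left cinner_tilde sum_subtractf quad_form_def)
  then show ?thesis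
    by (simp add: op_matrix_le_def op_matrix_nonneg_def)
qed

text \<open>
  A finite family has an upper bound \<open>h\<close>, and
  \<open>g\<^sub>i\<^sup>-\<^sup>1 g\<^sub>j = (g\<^sub>i\<^sup>-\<^sup>1 h) (g\<^sub>j\<^sup>-\<^sup>1 h)\<^sup>-\<^sup>1\<close>, so
  it is enough to test positivity on families in the cone.
\<close>

lemma regular_iff_quad_form_nonneg:
  "regular_representation G P T \<longleftrightarrow>
    (\<forall>n p u. (\<forall>i<n. p i \<in> P) \<longrightarrow> 0 \<le> quad_form n p u)"
proof
  assume reg: "regular_representation G P T"
  show "\<forall>n p u. (\<forall>i<n. p i \<in> P) \<longrightarrow> 0 \<le> quad_form n p u"
  proof (intro allI impI)
    fix n and p :: "nat \<Rightarrow> 'a" and u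
    assume p: "\<forall>i<n. p i \<in> P"
    show "0 \<le> quad_form n p u"
    proof (cases "n = 0")
      case True
      then show ?thesis by (simp add: quad_form_def)
    next
      case False
      have c: "i < n \<Longrightarrow> p i \<in> carrier G" for i
        using p cone_carrier by auto
      have "op_matrix_nonneg n (\<lambda>i j. tilde G P T (inv (inv (p i)) \<otimes> inv (p j)))"
        using reg False c
        unfolding regular_representation_def completely_positive_definite_def by simp
      then show ?thesis
        using c by (simp add: op_matrix_nonneg_tilde_iff quad_form_def)
    qed
  qed
next
  assume pos: "\<forall>n p u. (\<forall>i<n. p i \<in> P) \<longrightarrow> 0 \<le> quad_form n p u"
  have "op_matrix_nonneg n (\<lambda>i j. tilde G P T (inv (g i) \<otimes> g j))"
    if g: "\<forall>i<n. g i \<in> carrier G" for n and g :: "nat \<Rightarrow> 'a"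
  proof -
    obtain h where h: "h \<in> carrier G" "\<forall>x\<in>g ` {..<n}. x \<preceq> h"
      using g finite_upper_bound[of "g ` {..<n}"] by auto
    have "\<forall>i<n. inv (g i) \<otimes> h \<in> P"
      using h by (auto simp: cone_le_def)
    then have "0 \<le> quad_form n (\<lambda>i. inv (g i) \<otimes> h) u" for u
      using pos[rule_format, of n "\<lambda>i. inv (g i) \<otimes> h" u] by simp
    moreover have "inv (g i) \<otimes> h \<otimes> inv (inv (g j) \<otimes> h) = inv (g i) \<otimes> g j"
      if "i < n" "j < n" for i j
      using g h(1) that by (simp add: inv_mult_group m_assoc mult_inv_cancel)
    ultimately have "0 \<le> (\<Sum>i<n. \<Sum>j<n. tilde_form (inv (g i) \<otimes> g j) (u j) (u i))" for u
      by (simp add: quad_form_def)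
    then show ?thesis
      using g by (simp add: op_matrix_nonneg_tilde_iff)
  qed
  then show "regular_representation G P T"
    unfolding regular_representation_def completely_positive_definite_def
    by (simp add: tilde_bounded_ops tilde_one)
qed

section \<open>Positivity along disjoint factors\<close>

text \<open>
  With \<open>X\<close> the matrix of the family \<open>p\<close> and \<open>D\<close> the diagonal matrix with entries \<open>T g\<close>, the family
  consisting of all \<open>p\<^sub>i g\<close> and all \<open>p\<^sub>i\<close> has the block matrix with rows \<open>X, X D\<close> and
  \<open>D\<^sup>* X, X\<close>.  Its value at the vector \<open>(- D u, u)\<close> is that of \<open>X - D\<^sup>* X D\<close> at \<open>u\<close>.
\<close>

lemma quad_form_disjoint_le:
  assumes pos: "\<And>p u. (\<forall>i<n+n. p i \<in> P) \<Longrightarrow> 0 \<le> quad_form (n + n) p u"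
    and p: "\<And>i. i < n \<Longrightarrow> disjoint g (p i)"
    and g: "g \<in> P"
  shows "quad_form n p (\<lambda>i. T g (u i)) \<le> quad_form n p u"
proof -
  define q where "q i = (if i < n then p i \<otimes> g else p (i - n))" for i
  define v where "v i = (if i < n then - T g (u i) else u (i - n))" for i
  have P: "i < n \<Longrightarrow> p i \<in> P" for i
    using p disjoint_cone by blast
  have c: "i < n \<Longrightarrow> p i \<in> carrier G" "g \<in> carrier G" for i
    using P g cone_carrier by auto
  have cancel: "p i \<otimes> g \<otimes> inv (p j \<otimes> g) = p i \<otimes> inv (p j)" if "i < n" "j < n" for i j
    using that c by (simp add: inv_mult_group m_assoc mult_inv_cancel)
  have split: "(\<Sum>i<n+n. f i) = (\<Sum>i<n. f i) + (\<Sum>i<n. f (i + n))" for f :: "nat \<Rightarrow> complex"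
  proof -
    have "(\<Sum>i<n+m. f i) = (\<Sum>i<n. f i) + (\<Sum>i<m. f (i + n))" for m
      by (induction m) (simp_all add: add_ac)
    then show ?thesis .
  qed
  have "0 \<le> quad_form (n + n) q v"
    by (rule pos) (use P g in \<open>auto simp: q_def cone_mult_closed\<close>)
  also have "\<dots> = quad_form n p u - quad_form n p (\<lambda>i. T g (u i))"
    using c P p
    by (simp add: quad_form_def split q_def v_def cancel tilde_form_mult_disjoint
        sum.distrib sum_negf sum_subtractf)
  finally show ?thesis by simp
qed

text \<open>
  Dividing by \<open>g\<close> the members of the family that lie above \<open>g\<close> preserves the entries between them.
  If \<open>g\<close> is disjoint from the remaining members, an entry between a divided and a remaining member
  changes by a factor \<open>T g\<close> on the remaining side.  So the new family, evaluated at the vector with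
  \<open>T g\<close> applied to the remaining components, reproduces the form of the old family up to the entries
  among the remaining members, and that defect is the one that \<open>disj\<close> makes nonnegative.
\<close>

lemma quad_form_nonneg_divide:
  assumes disj: "\<And>p g u. \<lbrakk>\<And>i. i < n \<Longrightarrow> disjoint g (p i); g \<in> P\<rbrakk> \<Longrightarrow>
        quad_form n p (\<lambda>i. T g (u i)) \<le> quad_form n p u"
    and P: "\<And>i. i < n \<Longrightarrow> p i \<in> P" "g \<in> P"
    and above: "\<And>i. i < n \<Longrightarrow> i \<in> J \<Longrightarrow> g \<preceq> p i"
    and rest: "\<And>i. i < n \<Longrightarrow> i \<notin> J \<Longrightarrow> disjoint g (p i)"
    and pos: "\<And>u. 0 \<le> quad_form n (\<lambda>i. if i \<in> J then p i \<otimes> inv g else p i) u"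
  shows "0 \<le> quad_form n p u"
proof -
  define q where "q i = (if i \<in> J then p i \<otimes> inv g else p i)" for i
  define v where "v i = (if i \<in> J then u i else T g (u i))" for i
  \<comment> \<open>The subfamily of the remaining members, padded to the index range by components \<open>0\<close>.\<close>
  define r where "r i = (if i \<in> J then \<one> else p i)" for i
  define w where "w i = (if i \<in> J then 0 else u i)" for i
  have c: "i < n \<Longrightarrow> p i \<in> carrier G" "g \<in> carrier G" for i
    using P cone_carrier by auto
  have divP: "p i \<otimes> inv g \<in> P" if "i < n" "i \<in> J" for i
    using above[OF that] c that cone_le_mult_iff(2)[of g \<one> "p i"] by (simp add: one_cone_le_iff)
  have Tg0: "T g 0 = 0"
    using P(2) T_bounded_ops bounded_ops_apply by blast
  have "disjoint g \<one>"
    using P(2) by (simp add: disjoint_def one_in_cone)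
  then have r: "disjoint g (r i)" if "i < n" for i
    using rest[OF that] by (simp add: r_def)
  have entry: "tilde_form (p i \<otimes> inv (p j)) (u j) (u i) =
      tilde_form (q i \<otimes> inv (q j)) (v j) (v i)
      + (tilde_form (r i \<otimes> inv (r j)) (w j) (w i)
        - tilde_form (r i \<otimes> inv (r j)) (T g (w j)) (T g (w i)))"
    if ij: "i < n" "j < n" for i j
  proof -
    note cij = c(1)[OF ij(1)] c(1)[OF ij(2)] c(2)
    consider "i \<in> J" "j \<in> J" | "i \<in> J" "j \<notin> J" | "i \<notin> J" "j \<in> J" | "i \<notin> J" "j \<notin> J"
      by blast
    then show ?thesis
    proof cases
      case 1
      have "p i \<otimes> inv g \<otimes> inv (p j \<otimes> inv g) = p i \<otimes> inv (p j)"
        using cij by (simp add: inv_mult_group m_assoc mult_inv_cancel)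
      with 1 show ?thesis
        by (simp add: q_def v_def r_def w_def Tg0)
    next
      case 2
      have "tilde_form (p i \<otimes> inv g \<otimes> g \<otimes> inv (p j)) (u j) (u i)
          = tilde_form (p i \<otimes> inv g \<otimes> inv (p j)) (T g (u j)) (u i)"
        using 2 ij by (intro tilde_form_mult_disjoint divP rest)
      with 2 cij show ?thesis
        by (simp add: q_def v_def r_def w_def Tg0 m_assoc)
    next
      case 3
      have "tilde_form (p i \<otimes> inv (p j \<otimes> inv g \<otimes> g)) (u j) (u i)
          = tilde_form (p i \<otimes> inv (p j \<otimes> inv g)) (u j) (T g (u i))"
        using 3 ij by (intro tilde_form_mult_disjoint divP rest)
      with 3 cij show ?thesis
        by (simp add: q_def v_def r_def w_def Tg0 m_assoc)
    next
      case 4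
      then show ?thesis
        by (simp add: q_def v_def r_def w_def)
    qed
  qed
  have "quad_form n p u = quad_form n q v + (quad_form n r w - quad_form n r (\<lambda>i. T g (w i)))"
    by (simp add: quad_form_def entry sum.distrib sum_subtractf)
  moreover have "0 \<le> quad_form n q v"
    unfolding q_def[abs_def] by (rule pos)
  moreover have "quad_form n r (\<lambda>i. T g (w i)) \<le> quad_form n r w"
    using r P(2) by (rule disj)
  ultimately show ?thesis
    by simp
qed

text \<open>
  Induction on the number of nonempty index sets \<open>K\<close> such that the members \<open>p\<^sub>k\<close> with
  \<open>k \<in> K\<close> have a nontrivial meet.  If there is none, all members are the identity and the form is
  the squared norm of the sum of the vectors.  Otherwise divide the members over a set \<open>J\<close> of maximal
  size by their meet \<open>g\<close>: maximality makes \<open>g\<close> disjoint from the other members, the division makes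
  the meet over \<open>J\<close> trivial, and trivial meets remain trivial because the members decrease.
\<close>

lemma quad_form_nonneg:
  assumes disj: "\<And>p g u. \<lbrakk>\<And>i. i < n \<Longrightarrow> disjoint g (p i); g \<in> P\<rbrakk> \<Longrightarrow>
        quad_form n p (\<lambda>i. T g (u i)) \<le> quad_form n p u"
    and "\<And>i. i < n \<Longrightarrow> p i \<in> P"
  shows "0 \<le> quad_form n p u"
proof -
  define meeting where
    "meeting p = {K. K \<subseteq> {..<n} \<and> K \<noteq> {} \<and> (\<exists>x\<in>P. x \<noteq> \<one> \<and> (\<forall>k\<in>K. x \<preceq> p k))}"
    for p :: "nat \<Rightarrow> 'a"
  have finite: "finite (meeting p)" for p
    by (rule finite_subset[of _ "Pow {..<n}"]) (auto simp: meeting_def)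
  show ?thesis
    using assms(2)
  proof (induction "card (meeting p)" arbitrary: p u rule: less_induct)
    case less
    note P = less.prems
    have c: "i < n \<Longrightarrow> p i \<in> carrier G" for i
      using P cone_carrier by auto
    show ?case
    proof (cases "meeting p = {}")
      case True
      have "p i = \<one>" if "i < n" for i
      proof (rule ccontr)
        assume "p i \<noteq> \<one>"
        then have "{i} \<in> meeting p"
          using that P c cone_le_refl by (auto simp: meeting_def)
        with True show False by simp
      qed
      then have "quad_form n p u = cinner (\<Sum>i<n. u i) (\<Sum>i<n. u i)"
        by (simp add: quad_form_def tilde_form_one cinner_sum_left cinner_sum_right)
      then show ?thesis
        by (simp add: cinner_self less_eq_complex_def)
    next
      case False
      then have "Max (card ` meeting p) \<in> card ` meeting p"
        using finite by (intro Max_in) auto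
      then obtain J where J: "J \<in> meeting p" "card J = Max (card ` meeting p)"
        by auto
      have max: "card K \<le> card J" if "K \<in> meeting p" for K
        using that finite by (simp add: J(2))
      have Jn: "J \<subseteq> {..<n}" "J \<noteq> {}"
        using J(1) by (auto simp: meeting_def)
      obtain g where g_le: "\<forall>x\<in>p ` J. g \<preceq> x"
        and g_glb: "\<forall>y. (\<forall>x\<in>p ` J. y \<preceq> x) \<longrightarrow> y \<preceq> g"
        using finite_glb[of "p ` J"] Jn c finite_subset[OF Jn(1)] by blast
      have "\<one> \<preceq> g"
        using P Jn by (intro g_glb[rule_format]) (auto simp: one_cone_le_iff)
      then have g: "g \<in> P"
        by (simp add: one_cone_le_iff)
      have cg: "g \<in> carrier G"
        using g cone_carrier by blast
      define q where "q i = (if i \<in> J then p i \<otimes> inv g else p i)" for i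
      have q_le: "q i \<preceq> p i" if "i < n" for i
        using that c cg g cone_le_refl cone_le_left_cancel[of "p i" \<one> g]
        by (simp add: q_def cone_le_mult_iff one_cone_le_iff)
      have qP: "q i \<in> P" if "i < n" for i
        using that P c cg g_le cone_le_mult_iff(2)[of g \<one> "p i"]
        by (simp add: q_def flip: one_cone_le_iff)
      have "meeting q \<subseteq> meeting p"
      proof
        fix K assume "K \<in> meeting q"
        then obtain y where K: "K \<subseteq> {..<n}" "K \<noteq> {}"
          and y: "y \<in> P" "y \<noteq> \<one>" "\<forall>k\<in>K. y \<preceq> q k"
          by (auto simp: meeting_def)
        have "y \<preceq> p k" if "k \<in> K" for k
          using cone_le_trans y(3) q_le K(1) that by blast
        with K y show "K \<in> meeting p"
          by (auto simp: meeting_def)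
      qed
      moreover have "J \<notin> meeting q"
      proof
        assume "J \<in> meeting q"
        then obtain y where y: "y \<in> P" "y \<noteq> \<one>" "\<forall>k\<in>J. y \<preceq> q k"
          by (auto simp: meeting_def)
        have cy: "y \<in> carrier G"
          using y cone_carrier by blast
        have "y \<otimes> g \<preceq> p k" if "k \<in> J" for k
        proof -
          have "p k \<in> carrier G"
            using that Jn c by auto
          moreover have "y \<preceq> p k \<otimes> inv g"
            using that y(3) by (simp add: q_def)
          ultimately show ?thesis
            using cy cg by (simp add: cone_le_mult_iff)
        qed
        then have "y \<otimes> g \<preceq> \<one> \<otimes> g"
          using g_glb cg by simp
        then have "y \<preceq> \<one>"
          using cy cg by (subst (asm) cone_le_right_cancel) auto
        then have "y = \<one>"
          using y(1) by (intro cone_le_antisym) (simp_all add: one_cone_le_iff)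
        with y(2) show False by simp
      qed
      ultimately have "card (meeting q) < card (meeting p)"
        using J(1) finite by (intro psubset_card_mono) auto
      then have pos: "0 \<le> quad_form n q u" for u
        using qP by (rule less.hyps)
      have rest: "disjoint g (p i)" if i: "i < n" "i \<notin> J" for i
      proof -
        let ?m = "g \<sqinter>\<^bsub>cone_order G P\<^esub> p i"
        note meet = meet_glb[OF cg c[OF i(1)]]
        have m: "?m \<in> P"
          using meet(3)[of \<one>] g P i by (simp add: one_cone_le_iff)
        have "?m = \<one>"
        proof (rule ccontr)
          assume "?m \<noteq> \<one>"
          moreover have "\<forall>k\<in>insert i J. ?m \<preceq> p k"
            using meet(1,2) g_le cone_le_trans by blast
          ultimately have "insert i J \<in> meeting p"
            using m i Jn by (auto simp: meeting_def)
          then have "card (insert i J) \<le> card J"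
            by (rule max)
          then show False
            using i finite_subset[OF Jn(1)] by simp
        qed
        then show ?thesis
          using meet_eq_one_iff_disjoint g P i by blast
      qed
      show ?thesis
        using disj P g _ rest pos[unfolded q_def[abs_def]]
        by (rule quad_form_nonneg_divide) (use g_le in auto)
    qed
  qed
qed

end

section \<open>The characterisation of regularity\<close>

theorem theorem3p1:
  fixes G :: "('g, 'm) monoid_scheme" and P :: "'g set"
    and T :: "'g \<Rightarrow> 'h \<Rightarrow> 'h::chilbert_space"
  assumes "lattice_ordered_group G P"
    and "contractive_representation G P T"
  shows "regular_representation G P T \<longleftrightarrow>
    (\<forall>n\<ge>1. \<forall>p :: nat \<Rightarrow> 'g. \<forall>g\<in>P.
       (\<forall>i<n. p i \<in> P) \<and> (\<forall>i<n. g \<sqinter>\<^bsub>cone_order G P\<^esub> p i = \<one>\<^bsub>G\<^esub>) \<longrightarrow>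
       op_matrix_le n
         (\<lambda>i j. cadjoint (T g) \<circ> tilde G P T (p i \<otimes>\<^bsub>G\<^esub> inv\<^bsub>G\<^esub> (p j)) \<circ> T g)
         (\<lambda>i j. tilde G P T (p i \<otimes>\<^bsub>G\<^esub> inv\<^bsub>G\<^esub> (p j))))"
    (is "_ \<longleftrightarrow> ?disjoint_condition")
proof -
  interpret contractive_lattice_representation G P T
    using assms
    by (simp add: contractive_lattice_representation_def
        contractive_lattice_representation_axioms_def)
  show ?thesis
  proof
    assume "regular_representation G P T"
    then have pos: "\<And>n p u. \<forall>i<n. p i \<in> P \<Longrightarrow> 0 \<le> quad_form n p u"
      by (simp add: regular_iff_quad_form_nonneg)
    then show ?disjoint_condition
      by (auto simp: op_matrix_le_iff cone_carrier meet_eq_one_iff_disjoint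
          intro!: quad_form_disjoint_le)
  next
    assume cond: ?disjoint_condition
    have disj: "quad_form n p (\<lambda>i. T g (u i)) \<le> quad_form n p u"
      if "\<And>i. i < n \<Longrightarrow> disjoint g (p i)" "g \<in> P" for n p g u
    proof (cases "n = 0")
      case True
      then show ?thesis by (simp add: quad_form_def)
    next
      case False
      have p: "p i \<in> P" "g \<sqinter>\<^bsub>cone_order G P\<^esub> p i = \<one>\<^bsub>G\<^esub>" if "i < n" for i
        using \<open>\<And>i. i < n \<Longrightarrow> disjoint g (p i)\<close>[OF that] disjoint_cone meet_eq_one_iff_disjoint
        by blast+
      then have "op_matrix_le n
         (\<lambda>i j. cadjoint (T g) \<circ> tilde G P T (p i \<otimes>\<^bsub>G\<^esub> inv\<^bsub>G\<^esub> (p j)) \<circ> T g)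
         (\<lambda>i j. tilde G P T (p i \<otimes>\<^bsub>G\<^esub> inv\<^bsub>G\<^esub> (p j)))"
        using cond False \<open>g \<in> P\<close> by simp
      then show ?thesis
        using p \<open>g \<in> P\<close> by (simp add: op_matrix_le_iff cone_carrier)
    qed
    show "regular_representation G P T"
      unfolding regular_iff_quad_form_nonneg using quad_form_nonneg[OF disj] by blast
  qed
qed

end
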